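(* Every austere uniform commutative hemiring is a nucleus hemiring.
   Context: A (commutative) hemiring $(H,+,\cdot)$ is a set with $(H,+)$ a commutative monoid with identity $0$, $(H,\cdot)$ a commutative semigroup, multiplication distributing over addition, and $0h=0$ for all $h\in H$. No multiplicative identity is assumed. An ideal of $H$ is a nonempty subset $I$ with $a+b\in I$ and $ha\in I$ for all $a,b\in I$, $h\in H$. An ideal $I$ is subtractive if $x+y\in I$ and $x\in I$ imply $y\in I$, for all $x,y\in H$. $H$ is austere if its only subtractive ideals are $\{0\}$ and $H$. $H$ is uniform if $I\cap J\neq\{0\}$ for any two nonzero ideals $I,J$ of $H$. $\operatorname{Id}(H)$ is the lattice of ideals of $H$ ordered by inclusion, with meet given by intersection. $\operatorname{scl}_H(I)$ is the intersection of all subtractive ideals of $H$ containing $I$. A nucleus map on a meet-semilattice $(P,\le)$ is a function $\nu:P\to P$ such that for all $x,y\in P$: $x\le\nu(x)$; $\nu(\nu(x))=\nu(x)$; $\nu(x\wedge y)=\nu(x)\wedge\nu(y)$. $H$ is a nucleus hemiring if $\operatorname{scl}_H$ is a nucleus map on $\operatorname{Id}(H)$. *)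

theory Defs
  imports Main
begin

(* A commutative hemiring is a type of class comm_semiring_0, which assumes
   0 * a = 0 and no multiplicative identity. *)

definition is_ideal :: "'a::comm_semiring_0 set \<Rightarrow> bool" where
  "is_ideal I \<longleftrightarrow>
     I \<noteq> {} \<and> (\<forall>a\<in>I. \<forall>b\<in>I. a + b \<in> I) \<and> (\<forall>h. \<forall>a\<in>I. h * a \<in> I)"

definition subtractive :: "'a::comm_semiring_0 set \<Rightarrow> bool" where
  "subtractive I \<longleftrightarrow> (\<forall>x y. x + y \<in> I \<and> x \<in> I \<longrightarrow> y \<in> I)"

definition austere :: "'a::comm_semiring_0 itself \<Rightarrow> bool" where
  "austere _ \<longleftrightarrow> {I :: 'a set. is_ideal I \<and> subtractive I} = {{0}, UNIV}"

definition uniform :: "'a::comm_semiring_0 itself \<Rightarrow> bool" where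
  "uniform _ \<longleftrightarrow>
     (\<forall>I J :: 'a set. is_ideal I \<and> I \<noteq> {0} \<and> is_ideal J \<and> J \<noteq> {0} \<longrightarrow> I \<inter> J \<noteq> {0})"

lemma zero_in_ideal: "is_ideal I \<Longrightarrow> 0 \<in> I"
  unfolding is_ideal_def by (metis ex_in_conv mult_zero_left)

lemma is_ideal_Inter:
  assumes "\<And>I. I \<in> F \<Longrightarrow> is_ideal I"
  shows "is_ideal (\<Inter>F)"
proof -
  have "0 \<in> \<Inter>F"
    using assms zero_in_ideal by blast
  then show ?thesis
    using assms unfolding is_ideal_def by blast
qed

lemma is_ideal_Int: "is_ideal I \<Longrightarrow> is_ideal J \<Longrightarrow> is_ideal (I \<inter> J)"
  using is_ideal_Inter[of "{I, J}"] by auto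

lemma is_ideal_UNIV: "is_ideal UNIV"
  by (simp add: is_ideal_def)

typedef (overloaded) ('a::comm_semiring_0) ideal = "{I :: 'a set. is_ideal I}"
  morphisms carrier_of Abs_ideal
  using is_ideal_UNIV by blast

setup_lifting type_definition_ideal

instantiation ideal :: (comm_semiring_0) lattice
begin

lift_definition less_eq_ideal :: "'a ideal \<Rightarrow> 'a ideal \<Rightarrow> bool" is "(\<subseteq>)" .

lift_definition less_ideal :: "'a ideal \<Rightarrow> 'a ideal \<Rightarrow> bool" is "(\<subset>)" .

lift_definition inf_ideal :: "'a ideal \<Rightarrow> 'a ideal \<Rightarrow> 'a ideal" is "(\<inter>)"
  by (rule is_ideal_Int)

lift_definition sup_ideal :: "'a ideal \<Rightarrow> 'a ideal \<Rightarrow> 'a ideal"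
  is "\<lambda>I J. \<Inter>{K. is_ideal K \<and> I \<union> J \<subseteq> K}"
  by (rule is_ideal_Inter) simp

instance
  by standard (transfer; blast)+

end

definition nucleus_map :: "('p::semilattice_inf \<Rightarrow> 'p) \<Rightarrow> bool" where
  "nucleus_map \<nu> \<longleftrightarrow>
     (\<forall>x y. x \<le> \<nu> x \<and> \<nu> (\<nu> x) = \<nu> x \<and> \<nu> (inf x y) = inf (\<nu> x) (\<nu> y))"

lift_definition scl :: "'a::comm_semiring_0 ideal \<Rightarrow> 'a ideal"
  is "\<lambda>I. \<Inter>{J. is_ideal J \<and> subtractive J \<and> I \<subseteq> J}"
  by (rule is_ideal_Inter) simp

definition nucleus_hemiring :: "'a::comm_semiring_0 itself \<Rightarrow> bool" where
  "nucleus_hemiring _ \<longleftrightarrow> nucleus_map (scl :: 'a ideal \<Rightarrow> 'a ideal)"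

end

theory Submission imports Defs begin

text \<open>In an austere hemiring the subtractive closure fixes the zero ideal and sends every
  other ideal to the whole hemiring, so the only nontrivial nucleus law, preservation of meets,
  says that two nonzero ideals have nonzero intersection.\<close>

text \<open>By austerity the intersection defining \<open>scl I\<close> runs over at most
  \<open>{0}\<close> and \<open>UNIV\<close>, and \<open>{0}\<close> takes part exactly when it
  contains \<open>I\<close>.\<close>

lemma carrier_of_scl_austere:
  fixes I :: "'a::comm_semiring_0 ideal"
  assumes "austere TYPE('a)"
  shows "carrier_of (scl I) = (if carrier_of I = {0} then {0} else UNIV)"
proof -
  \<comment> \<open>Turns \<open>carrier_of I \<subseteq> {0}\<close> into equality.\<close>
  have "0 \<in> carrier_of I"
    using carrier_of zero_in_ideal by blast
  moreover have "is_ideal J \<and> subtractive J \<longleftrightarrow> J = {0} \<or> J = UNIV" for J :: "'a set"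
    using assms unfolding austere_def by blast
  ultimately show ?thesis
    by (auto simp: scl.rep_eq)
qed

theorem proposition4p12:
  assumes "austere TYPE('a::comm_semiring_0)"
    and "uniform TYPE('a)"
  shows "nucleus_hemiring TYPE('a)"
proof -
  note scl = carrier_of_scl_austere[OF assms(1)]
  have zero: "0 \<in> carrier_of I" and ideal: "is_ideal (carrier_of I)" for I :: "'a ideal"
    using carrier_of zero_in_ideal by blast+
  have "I \<le> scl I" for I :: "'a ideal"
    by (simp add: less_eq_ideal.rep_eq scl)
  moreover have "scl (scl I) = scl I" for I :: "'a ideal"
    by (simp add: carrier_of_inject[symmetric] scl)
  moreover have "scl (inf I J) = inf (scl I) (scl J)" for I J :: "'a ideal"
  proof -
    \<comment> \<open>Left to right is uniformity in contrapositive form; right to left holds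
      because both ideals contain \<open>0\<close>. This matches the case split of
      \<open>scl\<close> on the meet with those on \<open>I\<close> and \<open>J\<close>.\<close>
    have "carrier_of I \<inter> carrier_of J = {0} \<longleftrightarrow> carrier_of I = {0} \<or> carrier_of J = {0}"
      using assms(2) zero[of I] zero[of J] ideal unfolding uniform_def by blast
    then show ?thesis
      by (simp add: carrier_of_inject[symmetric] scl inf_ideal.rep_eq)
  qed
  ultimately show ?thesis
    unfolding nucleus_hemiring_def nucleus_map_def by blast
qed

end
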